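(* Let $d\ge 1$ be an integer, $r\in(0,1)$ and $\nu\in\mathbb{N}_+=\{1,2,\dots\}$. Then the random variable $W\sim \mathrm{CMB}_d(r,\nu)$ satisfies the SR (strongly Rayleigh) property. Moreover, the exchangeable Bernoulli random vector $\boldsymbol{I}^e_W\sim\mathrm{CMMB}_d(r,\nu)$ underlying $W$ satisfies the SR property.
   Context: Conway--Maxwell-binomial distribution: for an integer $d\ge1$, $r\in(0,1)$ and $\nu\in\mathbb{R}$, a random variable $W$ with values in $\{0,\dots,d\}$ has distribution $\mathrm{CMB}_d(r,\nu)$ if $$\mathbb{P}(W=k)=\frac{\binom{d}{k}^{\nu} r^k(1-r)^{d-k}}{S_d(r,\nu)},\quad k\in\{0,\dots,d\},\qquad S_d(r,\nu)=\sum_{k=0}^d\binom{d}{k}^{\nu} r^k(1-r)^{d-k}.$$ Underlying exchangeable vector: for a random variable $W$ on $\{0,\dots,d\}$, $\boldsymbol{I}^e_W=(I_1,\dots,I_d)$ denotes the (unique in distribution) exchangeable $\{0,1\}^d$-valued random vector such that $\sum_{j=1}^d I_j$ has the same distribution as $W$; that is, $\mathbb{P}(\boldsymbol{I}^e_W=\boldsymbol{i})=\mathbb{P}(W=k)/\binom{d}{k}$ for $\boldsymbol{i}\in\{0,1\}^d$ with $k=i_1+\dots+i_d$. If $W\sim\mathrm{CMB}_d(r,\nu)$, the distribution of $\boldsymbol{I}^e_W$ is called $\mathrm{CMMB}_d(r,\nu)$. SR property: a non-zero polynomial $\mathcal{P}\in\mathbb{C}[z_1,\dots,z_n]$ is stable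 if $\mathcal{P}(z_1,\dots,z_n)\ne0$ whenever $\Im(z_j)>0$ for all $j$; it is real stable if moreover its coefficients are real. (For a univariate real polynomial, real stability means that all its zeros are real.) A random variable $W$ on $\{0,\dots,d\}$ satisfies the SR property if its probability generating function $\mathcal{P}_W(z)=\sum_{k=0}^d\mathbb{P}(W=k)z^k$ is real stable. A $\{0,1\}^d$-valued random vector $\boldsymbol{I}$ satisfies the SR property if its joint probability generating function $\mathcal{P}_{\boldsymbol{I}}(z_1,\dots,z_d)=\sum_{\boldsymbol{i}\in\{0,1\}^d}\mathbb{P}(\boldsymbol{I}=\boldsymbol{i})z_1^{i_1}\cdots z_d^{i_d}$ is real stable. *)

theory Defs
  imports "HOL-Probability.Probability" "HOL-Library.Poly_Mapping"
begin

text \<open>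
  A polynomial in the variables \<open>z\<^sub>0, z\<^sub>1, \<dots>\<close> maps each monomial, given by its finitely supported
  exponent vector, to its coefficient.
\<close>

type_synonym 'a mpoly = "(nat \<Rightarrow>\<^sub>0 nat) \<Rightarrow>\<^sub>0 'a"

definition mpoly_vars :: "'a::zero mpoly \<Rightarrow> nat set" where
  "mpoly_vars p = (\<Union>m\<in>Poly_Mapping.keys p. Poly_Mapping.keys m)"

definition mpoly_eval :: "(nat \<Rightarrow> 'a) \<Rightarrow> 'a::comm_semiring_1 mpoly \<Rightarrow> 'a" where
  "mpoly_eval z p =
     (\<Sum>m\<in>Poly_Mapping.keys p.
        Poly_Mapping.lookup p m * (\<Prod>j\<in>Poly_Mapping.keys m. z j ^ Poly_Mapping.lookup m j))"

text \<open>The number of variables is an explicit argument; the variables are \<open>z\<^sub>0, \<dots>, z\<^sub>n\<^sub>-\<^sub>1\<close>.\<close>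

definition stable :: "nat \<Rightarrow> complex mpoly \<Rightarrow> bool" where
  "stable n p \<longleftrightarrow>
     p \<noteq> 0 \<and> mpoly_vars p \<subseteq> {..<n} \<and>
     (\<forall>z. (\<forall>j<n. Im (z j) > 0) \<longrightarrow> mpoly_eval z p \<noteq> 0)"

definition real_stable :: "nat \<Rightarrow> complex mpoly \<Rightarrow> bool" where
  "real_stable n p \<longleftrightarrow> stable n p \<and> (\<forall>m. Poly_Mapping.lookup p m \<in> \<real>)"

definition pgf :: "nat \<Rightarrow> 'a measure \<Rightarrow> ('a \<Rightarrow> nat) \<Rightarrow> complex mpoly" where
  "pgf d M W =
     (\<Sum>k\<le>d. Poly_Mapping.single (Poly_Mapping.single 0 k)
        (complex_of_real \<P>(\<omega> in M. W \<omega> = k)))"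

definition SR_variable :: "nat \<Rightarrow> 'a measure \<Rightarrow> ('a \<Rightarrow> nat) \<Rightarrow> bool" where
  "SR_variable d M W \<longleftrightarrow> real_stable 1 (pgf d M W)"

definition cube :: "nat \<Rightarrow> (nat \<Rightarrow> nat) set" where
  "cube d = ({..<d} \<rightarrow>\<^sub>E {0, 1})"

definition joint_pgf :: "nat \<Rightarrow> 'b measure \<Rightarrow> ('b \<Rightarrow> nat \<Rightarrow> nat) \<Rightarrow> complex mpoly" where
  "joint_pgf d N I =
     (\<Sum>i\<in>cube d. Poly_Mapping.single (\<Sum>j<d. Poly_Mapping.single j (i j))
        (complex_of_real \<P>(\<omega> in N. I \<omega> = i)))"

definition SR_vector :: "nat \<Rightarrow> 'b measure \<Rightarrow> ('b \<Rightarrow> nat \<Rightarrow> nat) \<Rightarrow> bool" where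
  "SR_vector d N I \<longleftrightarrow> real_stable d (joint_pgf d N I)"

definition CMB_weight :: "nat \<Rightarrow> real \<Rightarrow> real \<Rightarrow> nat \<Rightarrow> real" where
  "CMB_weight d r \<nu> k = real (d choose k) powr \<nu> * r ^ k * (1 - r) ^ (d - k)"

definition CMB_distributed :: "nat \<Rightarrow> real \<Rightarrow> real \<Rightarrow> 'a measure \<Rightarrow> ('a \<Rightarrow> nat) \<Rightarrow> bool" where
  "CMB_distributed d r \<nu> M W \<longleftrightarrow>
     prob_space M \<and> W \<in> measurable M (count_space {..d}) \<and>
     (\<forall>k\<le>d. \<P>(\<omega> in M. W \<omega> = k) = CMB_weight d r \<nu> k / (\<Sum>l\<le>d. CMB_weight d r \<nu> l))"

text \<open>
  A permutation of \<open>{..<d}\<close> fixes all other indices, so \<open>I \<omega> \<circ> \<pi>\<close> is again an element of \<open>cube d\<close>.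
\<close>

definition exchangeable :: "nat \<Rightarrow> 'b measure \<Rightarrow> ('b \<Rightarrow> nat \<Rightarrow> nat) \<Rightarrow> bool" where
  "exchangeable d N I \<longleftrightarrow>
     (\<forall>\<pi>. \<pi> permutes {..<d} \<longrightarrow>
        distr N (count_space (cube d)) (\<lambda>\<omega>. I \<omega> \<circ> \<pi>) = distr N (count_space (cube d)) I)"

definition underlying_vector ::
  "nat \<Rightarrow> 'a measure \<Rightarrow> ('a \<Rightarrow> nat) \<Rightarrow> 'b measure \<Rightarrow> ('b \<Rightarrow> nat \<Rightarrow> nat) \<Rightarrow> bool" where
  "underlying_vector d M W N I \<longleftrightarrow>
     prob_space N \<and> I \<in> measurable N (count_space (cube d)) \<and> exchangeable d N I \<and>
     distr N (count_space {..d}) (\<lambda>\<omega>. \<Sum>j<d. I \<omega> j) = distr M (count_space {..d}) W"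

lemma mpoly_eval_superset:
  assumes "finite A" "Poly_Mapping.keys p \<subseteq> A"
  shows "mpoly_eval z p =
    (\<Sum>m\<in>A. Poly_Mapping.lookup p m * (\<Prod>j\<in>Poly_Mapping.keys m. z j ^ Poly_Mapping.lookup m j))"
  unfolding mpoly_eval_def
  by (rule sum.mono_neutral_left) (use assms in \<open>auto simp: in_keys_iff\<close>)

lemma mpoly_eval_add: "mpoly_eval z (p + q) = mpoly_eval z p + mpoly_eval z q"
proof -
  let ?A = "Poly_Mapping.keys p \<union> Poly_Mapping.keys q"
  show ?thesis
    by (simp add: mpoly_eval_superset[of ?A p] mpoly_eval_superset[of ?A q]
        mpoly_eval_superset[of ?A "p + q"] Poly_Mapping.keys_add lookup_add sum.distrib algebra_simps)
qed

lemma mpoly_eval_sum: "mpoly_eval z (\<Sum>a\<in>A. p a) = (\<Sum>a\<in>A. mpoly_eval z (p a))"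
  by (induction A rule: infinite_finite_induct) (auto simp: mpoly_eval_add, auto simp: mpoly_eval_def)

lemma mpoly_eval_single:
  "mpoly_eval z (Poly_Mapping.single m c) =
     c * (\<Prod>j\<in>Poly_Mapping.keys m. z j ^ Poly_Mapping.lookup m j)"
  by (subst mpoly_eval_superset[of "{m}"]) auto

lemma mpoly_eval_pgf:
  "mpoly_eval z (pgf d M W) = (\<Sum>k\<le>d. complex_of_real \<P>(\<omega> in M. W \<omega> = k) * z 0 ^ k)"
  unfolding pgf_def mpoly_eval_sum mpoly_eval_single
  by (intro sum.cong refl) (simp add: lookup_single)

lemma mpoly_eval_joint_pgf:
  "mpoly_eval z (joint_pgf d N I) =
     (\<Sum>i\<in>cube d. complex_of_real \<P>(\<omega> in N. I \<omega> = i) * (\<Prod>j<d. z j ^ i j))"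
proof -
  have "(\<Prod>j\<in>Poly_Mapping.keys (\<Sum>j<d. Poly_Mapping.single j (i j)).
           z j ^ Poly_Mapping.lookup (\<Sum>j<d. Poly_Mapping.single j (i j)) j) = (\<Prod>j<d. z j ^ i j)"
    for i
  proof -
    have l: "Poly_Mapping.lookup (\<Sum>j<d. Poly_Mapping.single j (i j)) j = (if j < d then i j else 0)"
      for j
      by (simp add: lookup_sum lookup_single when_def)
    show ?thesis
      by (rule prod.mono_neutral_cong_left) (auto simp: in_keys_iff l split: if_splits)
  qed
  then show ?thesis
    by (simp add: joint_pgf_def mpoly_eval_sum mpoly_eval_single)
qed

lemma CMB_exists:
  assumes "0 < r" "r < 1"
  shows "\<exists>M (W :: nat \<Rightarrow> nat). CMB_distributed d r \<nu> M W"
proof -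
  define S where "S = (\<Sum>l\<le>d. CMB_weight d r \<nu> l)"
  have pos: "CMB_weight d r \<nu> k > 0" if "k \<le> d" for k
    using assms that by (auto simp: CMB_weight_def)
  have S: "S > 0"
    unfolding S_def by (rule sum_pos) (auto simp: pos)
  define f where "f k = CMB_weight d r \<nu> k / S" for k
  define M where "M = point_measure {..d} (\<lambda>k. ennreal (f k))"
  have f0: "0 \<le> f k" if "k \<le> d" for k
    using pos[OF that] S by (simp add: f_def)
  have e: "emeasure M X = ennreal (\<Sum>a\<in>X. f a)" if "X \<subseteq> {..d}" for X
    unfolding M_def using that f0
    by (subst emeasure_point_measure_finite) (auto intro!: sum_ennreal)
  have "prob_space M"
  proof
    have "(\<Sum>a\<le>d. f a) = 1"
      unfolding f_def sum_divide_distrib[symmetric] using S by (simp add: S_def)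
    then show "emeasure M (space M) = 1"
      using e[of "{..d}"] by (simp add: M_def space_point_measure)
  qed
  moreover have "id \<in> measurable M (count_space {..d})"
    by (auto simp: M_def measurable_def space_point_measure sets_point_measure)
  moreover have "\<P>(\<omega> in M. id \<omega> = k) = f k" if "k \<le> d" for k
  proof -
    have "{\<omega> \<in> space M. id \<omega> = k} = {k}"
      using that by (auto simp: M_def space_point_measure)
    then show ?thesis
      using e[of "{k}"] f0[OF that] that by (simp add: measure_def)
  qed
  ultimately show ?thesis
    unfolding CMB_distributed_def f_def S_def by blast
qed

lemma finite_cube [simp]: "finite (cube d)"
  by (auto simp: cube_def intro: finite_PiE)

lemma cube_values: "i \<in> cube d \<Longrightarrow> j < d \<Longrightarrow> i j = 0 \<or> i j = 1"
  by (auto simp: cube_def PiE_def Pi_def)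

lemma cube_outside: "i \<in> cube d \<Longrightarrow> \<not> j < d \<Longrightarrow> i j = undefined"
  by (simp add: cube_def PiE_arb[of i "{..<d}"])

lemma cube_sum: "i \<in> cube d \<Longrightarrow> (\<Sum>j<d. i j) = card {j. j < d \<and> i j = 1}"
proof -
  assume i: "i \<in> cube d"
  have "(\<Sum>j<d. i j) = (\<Sum>j<d. if i j = 1 then 1 else 0)"
    using cube_values[OF i] by (intro sum.cong) auto
  also have "\<dots> = card ({..<d} \<inter> {j. i j = 1})"
    by (simp add: sum.If_cases)
  also have "{..<d} \<inter> {j. i j = 1} = {j. j < d \<and> i j = 1}"
    by auto
  finally show ?thesis .
qed

lemma cube_sum_le: "i \<in> cube d \<Longrightarrow> (\<Sum>j<d. i j) \<le> d"
proof -
  assume i: "i \<in> cube d"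
  have "card {j. j < d \<and> i j = 1} \<le> card {..<d}"
    by (rule card_mono) auto
  then show ?thesis
    by (simp add: cube_sum[OF i])
qed

lemma card_cube_sum: "card {i \<in> cube d. (\<Sum>j<d. i j) = k} = d choose k"
proof -
  let ?g = "\<lambda>A. \<lambda>j\<in>{..<d}. if j \<in> A then 1 else (0::nat)"
  let ?A = "{A. A \<subseteq> {..<d} \<and> card A = k}" and ?B = "{i \<in> cube d. (\<Sum>j<d. i j) = k}"
  have c: "?g A \<in> cube d" for A
    by (auto simp: cube_def)
  have "bij_betw ?g ?A ?B"
  proof (rule bij_betw_byWitness[where f' = "\<lambda>i. {j. j < d \<and> i j = 1}"])
    show "\<forall>A\<in>?A. {j. j < d \<and> ?g A j = 1} = A"
      by auto
    show "\<forall>i\<in>?B. ?g {j. j < d \<and> i j = 1} = i"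
    proof (intro ballI ext)
      fix i j assume i: "i \<in> ?B"
      show "?g {j. j < d \<and> i j = 1} j = i j"
      proof (cases "j < d")
        case True
        then show ?thesis
          using i cube_values[of i d j] by fastforce
      next
        case False
        then show ?thesis
          using i cube_outside[of i d j] by simp
      qed
    qed
    show "?g ` ?A \<subseteq> ?B"
    proof clarify
      fix A assume A: "A \<subseteq> {..<d}" "k = card A"
      have "{j. j < d \<and> ?g A j = 1} = A"
        using A by auto
      then show "?g A \<in> cube d \<and> (\<Sum>j<d. ?g A j) = card A"
        using cube_sum[OF c, of A] c by simp
    qed
    show "(\<lambda>i. {j. j < d \<and> i j = 1}) ` ?B \<subseteq> ?A"
      using cube_sum by auto
  qed
  from bij_betw_same_card[OF this] n_subsets[of "{..<d}" k] show ?thesis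
    by simp
qed

lemma cube_comp_permutes:
  assumes \<pi>: "\<pi> permutes {..<d}" and i: "i \<in> cube d"
  shows "i \<circ> \<pi> \<in> cube d"
  unfolding cube_def
proof (rule PiE_I)
  fix j assume "j \<in> {..<d}"
  then have "\<pi> j < d"
    using permutes_in_image[OF \<pi>] by auto
  then show "(i \<circ> \<pi>) j \<in> {0, 1}"
    using cube_values[OF i] by simp
next
  fix j assume "j \<notin> {..<d}"
  then show "(i \<circ> \<pi>) j = undefined"
    using permutes_not_in[OF \<pi>] cube_outside[OF i] by simp
qed

lemma cube_permutes_ex:
  assumes i: "i \<in> cube d" "i' \<in> cube d" and s: "(\<Sum>j<d. i j) = (\<Sum>j<d. i' j)"
  obtains \<pi> where "\<pi> permutes {..<d}" "i \<circ> \<pi> = i'"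
proof -
  let ?A = "\<lambda>i::nat \<Rightarrow> nat. {j. j < d \<and> i j = 1}" and ?B = "\<lambda>i::nat \<Rightarrow> nat. {j. j < d \<and> i j \<noteq> 1}"
  have B: "?B i = {..<d} - ?A i" for i
    by auto
  have cA: "card (?A i') = card (?A i)"
    using s i by (simp add: cube_sum)
  have cB: "card (?B i') = card (?B i)"
    unfolding B using cA by (subst (1 2) card_Diff_subset) auto
  obtain f g where f: "bij_betw f (?A i') (?A i)" and g: "bij_betw g (?B i') (?B i)"
    using cA cB finite_same_card_bij[of "?A i'" "?A i"] finite_same_card_bij[of "?B i'" "?B i"]
    by auto
  define \<pi> where "\<pi> j = (if j < d then if i' j = 1 then f j else g j else j)" for j
  have "bij_betw \<pi> (?A i' \<union> ?B i') (?A i \<union> ?B i)"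
  proof (rule bij_betw_combine)
    show "bij_betw \<pi> (?A i') (?A i)"
      using f by (subst bij_betw_cong[of _ _ f]) (auto simp: \<pi>_def)
    show "bij_betw \<pi> (?B i') (?B i)"
      using g by (subst bij_betw_cong[of _ _ g]) (auto simp: \<pi>_def)
  qed auto
  moreover have "?A i \<union> ?B i = {..<d}" for i
    by auto
  ultimately have "bij_betw \<pi> {..<d} {..<d}"
    by simp
  then have p: "\<pi> permutes {..<d}"
    by (rule bij_imp_permutes) (auto simp: \<pi>_def)
  have "(i \<circ> \<pi>) j = i' j" for j
  proof (cases "j < d")
    case True
    show ?thesis
    proof (cases "i' j = 1")
      case True': True
      then have "f j \<in> ?A i"
        using f True by (auto dest: bij_betwE)
      then show ?thesis
        using True True' by (simp add: \<pi>_def)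
    next
      case False
      then have "g j \<in> ?B i"
        using g True by (auto dest: bij_betwE)
      then show ?thesis
        using True False cube_values[OF i(1), of "g j"] cube_values[OF i(2), of j]
        by (auto simp: \<pi>_def)
    qed
  next
    case False
    then show ?thesis
      using i by (simp add: \<pi>_def cube_outside[of _ d])
  qed
  then have "i \<circ> \<pi> = i'"
    by (rule ext)
  with p show thesis
    by (rule that)
qed

lemma distr_count_space_eq_iff:
  assumes "finite A" "prob_space M" "prob_space N"
    and "f \<in> measurable M (count_space A)" "g \<in> measurable N (count_space A)"
  shows "distr M (count_space A) f = distr N (count_space A) g \<longleftrightarrow>
    (\<forall>a\<in>A. \<P>(\<omega> in M. f \<omega> = a) = \<P>(\<omega> in N. g \<omega> = a))"
proof -
  interpret M: prob_space M by fact
  interpret N: prob_space N by fact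
  have e: "emeasure (distr K (count_space A) h) {a} = ennreal (\<P>(\<omega> in K. h \<omega> = a))"
    if "prob_space K" "h \<in> measurable K (count_space A)" "a \<in> A" for K :: "'z measure" and h a
  proof -
    interpret K: prob_space K by fact
    have "h -` {a} \<inter> space K = {\<omega> \<in> space K. h \<omega> = a}"
      by auto
    then show ?thesis
      using that by (simp add: emeasure_distr K.emeasure_eq_measure)
  qed
  show ?thesis
  proof
    assume eq: "distr M (count_space A) f = distr N (count_space A) g"
    show "\<forall>a\<in>A. \<P>(\<omega> in M. f \<omega> = a) = \<P>(\<omega> in N. g \<omega> = a)"
    proof
      fix a assume "a \<in> A"
      then have "ennreal (\<P>(\<omega> in M. f \<omega> = a)) = ennreal (\<P>(\<omega> in N. g \<omega> = a))"
        using e[OF assms(2,4)] e[OF assms(3,5)] eq by metis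
      then show "\<P>(\<omega> in M. f \<omega> = a) = \<P>(\<omega> in N. g \<omega> = a)"
        by simp
    qed
  next
    assume "\<forall>a\<in>A. \<P>(\<omega> in M. f \<omega> = a) = \<P>(\<omega> in N. g \<omega> = a)"
    then show "distr M (count_space A) f = distr N (count_space A) g"
      using assms e[OF assms(2,4)] e[OF assms(3,5)]
      by (intro measure_eqI_finite[where A = A]) auto
  qed
qed

text \<open>
  The two descriptions of the underlying exchangeable vector, via exchangeability and the law of the
  sum or via point probabilities, agree; in particular its distribution is unique.
\<close>

lemma underlying_vector_iff:
  fixes M :: "'a measure" and N :: "'b measure"
  assumes M: "prob_space M" and W: "W \<in> measurable M (count_space {..d})"
  shows "underlying_vector d M W N I \<longleftrightarrow>
    prob_space N \<and> I \<in> measurable N (count_space (cube d)) \<and>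
    (\<forall>i\<in>cube d. \<P>(\<omega> in N. I \<omega> = i) = \<P>(\<omega> in M. W \<omega> = (\<Sum>j<d. i j)) / real (d choose (\<Sum>j<d. i j)))"
proof (cases "prob_space N \<and> I \<in> measurable N (count_space (cube d))")
  case False
  then show ?thesis
    by (auto simp: underlying_vector_def)
next
  case True
  then interpret N: prob_space N by simp
  have I: "I \<in> measurable N (count_space (cube d))"
    using True by simp
  have Ic: "I \<omega> \<in> cube d" if "\<omega> \<in> space N" for \<omega>
    using measurable_space[OF I that] by simp
  have sI: "(\<lambda>\<omega>. \<Sum>j<d. I \<omega> j) \<in> measurable N (count_space {..d})"
    by (rule measurable_compose[OF I]) (auto simp: cube_sum_le)
  have pI: "(\<lambda>\<omega>. I \<omega> \<circ> \<pi>) \<in> measurable N (count_space (cube d))" if "\<pi> permutes {..<d}" for \<pi>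
    by (rule measurable_compose[OF I]) (use cube_comp_permutes[OF that] in \<open>auto simp: o_def\<close>)
  have set: "{\<omega> \<in> space N. I \<omega> = i} \<in> sets N" for i
  proof (cases "i \<in> cube d")
    case True
    then have "I -` {i} \<inter> space N \<in> sets N"
      using I by (auto intro: measurable_sets)
    moreover have "I -` {i} \<inter> space N = {\<omega> \<in> space N. I \<omega> = i}"
      by auto
    ultimately show ?thesis
      by simp
  next
    case False
    then have "{\<omega> \<in> space N. I \<omega> = i} = {}"
      using Ic by auto
    then show ?thesis
      by (simp only: sets.empty_sets)
  qed
  have tot: "\<P>(\<omega> in N. (\<Sum>j<d. I \<omega> j) = k) =
      (\<Sum>i\<in>{i \<in> cube d. (\<Sum>j<d. i j) = k}. \<P>(\<omega> in N. I \<omega> = i))" for k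
  proof -
    have "{\<omega> \<in> space N. (\<Sum>j<d. I \<omega> j) = k} =
        (\<Union>i\<in>{i \<in> cube d. (\<Sum>j<d. i j) = k}. {\<omega> \<in> space N. I \<omega> = i})"
      using Ic by auto
    then show ?thesis
      using set by (simp add: N.finite_measure_finite_Union disjoint_family_on_def image_subset_iff
          disjoint_iff)
  qed
  have perm: "\<P>(\<omega> in N. I \<omega> \<circ> \<pi> = i) = \<P>(\<omega> in N. I \<omega> = i \<circ> inv \<pi>)"
    if "\<pi> permutes {..<d}" for \<pi> i
  proof -
    have "I \<omega> \<circ> \<pi> = i \<longleftrightarrow> I \<omega> = i \<circ> inv \<pi>" for \<omega>
      using permutes_inv_o[OF that] by (metis comp_assoc comp_id)
    then show ?thesis
      by simp
  qed
  have ex: "exchangeable d N I \<longleftrightarrow>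
      (\<forall>\<pi>. \<pi> permutes {..<d} \<longrightarrow>
        (\<forall>i\<in>cube d. \<P>(\<omega> in N. I \<omega> = i \<circ> inv \<pi>) = \<P>(\<omega> in N. I \<omega> = i)))"
    unfolding exchangeable_def
    using distr_count_space_eq_iff[OF finite_cube N.prob_space_axioms N.prob_space_axioms pI I] perm
    by simp
  have law: "distr N (count_space {..d}) (\<lambda>\<omega>. \<Sum>j<d. I \<omega> j) = distr M (count_space {..d}) W \<longleftrightarrow>
      (\<forall>k\<le>d. \<P>(\<omega> in N. (\<Sum>j<d. I \<omega> j) = k) = \<P>(\<omega> in M. W \<omega> = k))"
    by (subst distr_count_space_eq_iff[OF _ N.prob_space_axioms M sI W]) auto
  have "(exchangeable d N I \<and>
      distr N (count_space {..d}) (\<lambda>\<omega>. \<Sum>j<d. I \<omega> j) = distr M (count_space {..d}) W) \<longleftrightarrow>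
    (\<forall>i\<in>cube d. \<P>(\<omega> in N. I \<omega> = i) = \<P>(\<omega> in M. W \<omega> = (\<Sum>j<d. i j)) / real (d choose (\<Sum>j<d. i j)))"
    (is "?L \<longleftrightarrow> ?R")
  proof
    assume L: ?L
    show ?R
    proof
      fix i assume i: "i \<in> cube d"
      define k where "k = (\<Sum>j<d. i j)"
      have k: "k \<le> d"
        unfolding k_def by (rule cube_sum_le[OF i])
      have eq: "\<P>(\<omega> in N. I \<omega> = i') = \<P>(\<omega> in N. I \<omega> = i)"
        if i': "i' \<in> {i \<in> cube d. (\<Sum>j<d. i j) = k}" for i'
      proof -
        obtain \<pi> where \<pi>: "\<pi> permutes {..<d}" "i \<circ> \<pi> = i'"
          using cube_permutes_ex[OF i, of i'] i' k_def by auto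
        have "\<P>(\<omega> in N. I \<omega> = i \<circ> inv (inv \<pi>)) = \<P>(\<omega> in N. I \<omega> = i)"
          using L i permutes_inv[OF \<pi>(1)] unfolding ex by blast
        then show ?thesis
          using \<pi> by (simp add: permutes_inv_inv)
      qed
      have "\<P>(\<omega> in M. W \<omega> = k) = \<P>(\<omega> in N. (\<Sum>j<d. I \<omega> j) = k)"
        using L k unfolding law by simp
      also have "\<dots> = (\<Sum>i\<in>{i \<in> cube d. (\<Sum>j<d. i j) = k}. \<P>(\<omega> in N. I \<omega> = i))"
        by (rule tot)
      also have "\<dots> = (\<Sum>i'\<in>{i \<in> cube d. (\<Sum>j<d. i j) = k}. \<P>(\<omega> in N. I \<omega> = i))"
        by (rule sum.cong[OF refl eq])
      also have "\<dots> = real (d choose k) * \<P>(\<omega> in N. I \<omega> = i)"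
        by (simp add: card_cube_sum)
      finally have "\<P>(\<omega> in M. W \<omega> = k) = real (d choose k) * \<P>(\<omega> in N. I \<omega> = i)" .
      then show "\<P>(\<omega> in N. I \<omega> = i) = \<P>(\<omega> in M. W \<omega> = (\<Sum>j<d. i j)) / real (d choose (\<Sum>j<d. i j))"
        using k by (simp add: k_def[symmetric])
    qed
  next
    assume R: ?R
    have "exchangeable d N I"
      unfolding ex
    proof (intro allI impI ballI)
      fix \<pi> i assume \<pi>: "\<pi> permutes {..<d}" and i: "i \<in> cube d"
      have \<pi>': "inv \<pi> permutes {..<d}"
        by (rule permutes_inv[OF \<pi>])
      have "(\<Sum>j<d. (i \<circ> inv \<pi>) j) = (\<Sum>j<d. i j)"
        using sum.permute[OF \<pi>', of i] by simp
      then show "\<P>(\<omega> in N. I \<omega> = i \<circ> inv \<pi>) = \<P>(\<omega> in N. I \<omega> = i)"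
        using R i cube_comp_permutes[OF \<pi>' i] by simp
    qed
    moreover have "\<P>(\<omega> in N. (\<Sum>j<d. I \<omega> j) = k) = \<P>(\<omega> in M. W \<omega> = k)" if "k \<le> d" for k
      using that R by (simp add: tot card_cube_sum)
    ultimately show ?L
      unfolding law by simp
  qed
  then show ?thesis
    using True by (simp add: underlying_vector_def)
qed

lemma underlying_vector_exists:
  fixes M :: "'a measure"
  assumes M: "prob_space M" and W: "W \<in> measurable M (count_space {..d})"
  shows "\<exists>N (I :: (nat \<Rightarrow> nat) \<Rightarrow> nat \<Rightarrow> nat). underlying_vector d M W N I"
proof -
  interpret M: prob_space M by fact
  define f where "f i = \<P>(\<omega> in M. W \<omega> = (\<Sum>j<d. i j)) / real (d choose (\<Sum>j<d. i j))" for i :: "nat \<Rightarrow> nat"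
  define N where "N = point_measure (cube d) (\<lambda>i. ennreal (f i))"
  have f0: "0 \<le> f i" for i
    by (simp add: f_def)
  have e: "emeasure N X = ennreal (\<Sum>a\<in>X. f a)" if "X \<subseteq> cube d" for X
    unfolding N_def using that f0
    by (subst emeasure_point_measure_finite) (auto intro!: sum_ennreal)
  have "prob_space N"
  proof
    have set: "{\<omega> \<in> space M. W \<omega> = k} \<in> sets M" if "k \<le> d" for k
    proof -
      have "W -` {k} \<inter> space M \<in> sets M"
        using W that by (auto intro: measurable_sets)
      moreover have "W -` {k} \<inter> space M = {\<omega> \<in> space M. W \<omega> = k}"
        by auto
      ultimately show ?thesis
        by simp
    qed
    have "space M = (\<Union>k\<in>{..d}. {\<omega> \<in> space M. W \<omega> = k})"
      using measurable_space[OF W] by auto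
    then have "measure M (space M) = (\<Sum>k\<le>d. \<P>(\<omega> in M. W \<omega> = k))"
      using set M.finite_measure_finite_Union[of "{..d}" "\<lambda>k. {\<omega> \<in> space M. W \<omega> = k}"]
      by (auto simp: disjoint_family_on_def)
    then have one: "(\<Sum>k\<le>d. \<P>(\<omega> in M. W \<omega> = k)) = 1"
      using M.prob_space by simp
    have "(\<Sum>i\<in>cube d. f i) = (\<Sum>k\<le>d. \<Sum>i\<in>{i \<in> cube d. (\<Sum>j<d. i j) = k}. f i)"
      by (rule sum.group[symmetric]) (auto simp: cube_sum_le)
    also have "\<dots> = (\<Sum>k\<le>d. \<P>(\<omega> in M. W \<omega> = k))"
      by (intro sum.cong refl) (simp add: f_def card_cube_sum)
    finally show "emeasure N (space N) = 1"
      using e[of "cube d"] one by (simp add: N_def space_point_measure)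
  qed
  moreover have "id \<in> measurable N (count_space (cube d))"
    by (auto simp: N_def measurable_def space_point_measure sets_point_measure)
  moreover have "\<P>(\<omega> in N. id \<omega> = i) = f i" if "i \<in> cube d" for i
  proof -
    have "{\<omega> \<in> space N. id \<omega> = i} = {i}"
      using that by (auto simp: N_def space_point_measure)
    then show ?thesis
      using e[of "{i}"] f0 that by (simp add: measure_def)
  qed
  ultimately show ?thesis
    unfolding underlying_vector_iff[OF M W] f_def by blast
qed

end

theory Submission
  imports Defs "HOL-Computational_Algebra.Fundamental_Theorem_Algebra"
begin

text \<open>
  For \<open>\<nu> = 1\<close> the generating function is a power of \<open>1 - r + r x\<close>. Multiplying the coefficients of
  \<open>\<Sum>k\<le>d. a\<^sub>k x\<^sup>k\<close> by \<open>d choose k\<close> keeps all zeros in \<open>(-\<infinity>, 0]\<close>, by Gauss--Lucas; so the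
  univariate generating function has only real zeros for every \<open>\<nu> \<ge> 1\<close>. The joint generating function
  of the exchangeable vector is its polarization, which is stable by the Grace--Walsh--Szego theorem.
\<close>

section \<open>Bounds on the logarithmic derivative of a complex polynomial\<close>

text \<open>Take \<open>S\<close> as the sum of the \<open>1 / (x - a)\<close> and \<open>T\<close>
  as the sum of their squared moduli. The bound on \<open>S\<close> is Cauchy--Schwarz; the other
  two hold summand by summand, as \<open>1 / (x - a)\<close> has imaginary part
  \<open>- (Im x - Im a)\<close> times its squared modulus.\<close>

lemma log_derivative_prod_linear:
  fixes x :: complex
  assumes "\<forall>a\<in>#A. Im a < Im x"
  obtains S :: complex and T :: real where "poly (pderiv (\<Prod>a\<in>#A. [:-a, 1:])) x = S * poly (\<Prod>a\<in>#A. [:-a, 1:]) x"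
    and "(cmod S)\<^sup>2 \<le> size A * T" "(\<forall>a\<in>#A. Im a \<le> 0) \<longrightarrow> Im x * T \<le> - Im S"
    and "A \<noteq> {#} \<longrightarrow> Im S < 0"
proof -
  have "\<exists>S (T::real). poly (pderiv (\<Prod>a\<in>#A. [:-a, 1:])) x = S * poly (\<Prod>a\<in>#A. [:-a, 1:]) x \<and> 0 \<le> T \<and>
    (cmod S)\<^sup>2 \<le> size A * T \<and> ((\<forall>a\<in>#A. Im a \<le> 0) \<longrightarrow> Im x * T \<le> - Im S) \<and>
    (A \<noteq> {#} \<longrightarrow> Im S < 0) \<and> Im S \<le> 0"
    using assms
  proof (induction A)
    case empty
    show ?case
      by (rule exI[of _ 0], rule exI[of _ 0]) (simp add: pderiv_1)
  next
    case (add a A)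
    then obtain S and T :: real where IH: "poly (pderiv (\<Prod>a\<in>#A. [:-a, 1:])) x = S * poly (\<Prod>a\<in>#A. [:-a, 1:]) x"
      "0 \<le> T" "(cmod S)\<^sup>2 \<le> size A * T" "(\<forall>a\<in>#A. Im a \<le> 0) \<longrightarrow> Im x * T \<le> - Im S" "Im S \<le> 0"
      by auto
    define u where "u = 1 / (x - a)"
    have a: "Im a < Im x" "x \<noteq> a"
      using add.prems by auto
    have Imu: "Im u = - (Im x - Im a) * (cmod u)\<^sup>2"
      by (simp add: u_def Im_divide cmod_power2 norm_divide power_divide)
    have u0: "(cmod u)\<^sup>2 > 0"
      using a by (simp add: u_def)
    have "poly (pderiv (\<Prod>a\<in>#add_mset a A. [:-a, 1:])) x =
        (S + u) * poly (\<Prod>a\<in>#add_mset a A. [:-a, 1:]) x"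
    proof -
      have "u * (x - a) = 1"
        using a by (simp add: u_def)
      have "poly (pderiv (\<Prod>a\<in>#add_mset a A. [:-a, 1:])) x =
          (x - a) * (S * poly (\<Prod>a\<in>#A. [:-a, 1:]) x) + poly (\<Prod>a\<in>#A. [:-a, 1:]) x"
        unfolding image_mset_add_mset prod_mset.add_mset pderiv_mult poly_add poly_mult IH(1)
        by (simp add: pderiv_pCons)
      also have "\<dots> = (x - a) * (S * poly (\<Prod>a\<in>#A. [:-a, 1:]) x) + u * (x - a) * poly (\<Prod>a\<in>#A. [:-a, 1:]) x"
        unfolding \<open>u * (x - a) = 1\<close> by simp
      also have "\<dots> = (S + u) * poly (\<Prod>a\<in>#add_mset a A. [:-a, 1:]) x"
        unfolding image_mset_add_mset prod_mset.add_mset poly_mult by (simp add: algebra_simps)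
      finally show ?thesis .
    qed
    moreover have "(cmod (S + u))\<^sup>2 \<le> size (add_mset a A) * (T + (cmod u)\<^sup>2)"
    proof -
      \<comment> \<open>Cauchy--Schwarz, one term at a time: the cross term is controlled by
        squaring \<open>cmod S - n * cmod u\<close>.\<close>
      have "2 * cmod S * cmod u \<le> T + size A * (cmod u)\<^sup>2"
      proof (cases "A = {#}")
        case True
        then show ?thesis using IH(2,3) by simp
      next
        case False
        define n where "n = real (size A)"
        have n: "n > 0"
          using False by (simp add: n_def nonempty_has_size)
        have "0 \<le> (cmod S - n * cmod u)\<^sup>2"
          by simp
        also have "\<dots> = (cmod S)\<^sup>2 + n\<^sup>2 * (cmod u)\<^sup>2 - n * (2 * cmod S * cmod u)"
          by (simp add: power2_eq_square algebra_simps)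
        also have "\<dots> \<le> n * (T + n * (cmod u)\<^sup>2 - 2 * cmod S * cmod u)"
          using IH(3) by (simp add: power2_eq_square algebra_simps n_def)
        finally show ?thesis
          using n False by (auto simp: zero_le_mult_iff n_def)
      qed
      moreover have "(cmod (S + u))\<^sup>2 \<le> (cmod S + cmod u)\<^sup>2"
        by (intro power_mono norm_triangle_ineq) auto
      ultimately show ?thesis
        using IH(3) unfolding power2_sum by (simp add: distrib_left distrib_right)
    qed
    moreover have "Im x * (T + (cmod u)\<^sup>2) \<le> - Im (S + u)" if "\<forall>b\<in>#add_mset a A. Im b \<le> 0"
    proof -
      have "Im x * (cmod u)\<^sup>2 \<le> (Im x - Im a) * (cmod u)\<^sup>2"
        using that by (intro mult_right_mono) auto
      also have "\<dots> = - Im u"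
        unfolding Imu by (simp add: algebra_simps)
      finally have "Im x * (cmod u)\<^sup>2 \<le> - Im u" .
      moreover have "Im x * T \<le> - Im S"
        using that IH(4) by simp
      ultimately show ?thesis
        by (simp add: distrib_left)
    qed
    moreover have "Im (S + u) < 0"
    proof -
      have "Im u < 0"
        unfolding Imu using u0 a by (simp add: mult_neg_pos)
      then show ?thesis
        using IH(5) by simp
    qed
    moreover from this have "Im (S + u) \<le> 0"
      by (rule less_imp_le)
    moreover have "0 \<le> T + (cmod u)\<^sup>2"
      using IH(2) by simp
    ultimately show ?case
      by (intro exI[of _ "S + u"] exI[of _ "T + (cmod u)\<^sup>2"] conjI allI impI)
  qed
  then show thesis
    using that by blast
qed

text \<open>\<open>p\<close> is a constant times the product over its zeros with multiplicity, and
  the constant cancels in the logarithmic derivative.\<close>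

lemma log_derivative_poly:
  fixes p :: "complex poly"
  assumes "p \<noteq> 0" and "\<And>a. poly p a = 0 \<Longrightarrow> Im a < Im x"
  obtains S :: complex and T :: real where "poly (pderiv p) x = S * poly p x"
    and "(cmod S)\<^sup>2 \<le> degree p * T" "(\<forall>a. poly p a = 0 \<longrightarrow> Im a \<le> 0) \<longrightarrow> Im x * T \<le> - Im S"
    and "degree p > 0 \<longrightarrow> Im S < 0"
proof -
  define A where "A = proots p"
  have p: "p = smult (lead_coeff p) (\<Prod>a\<in>#A. [:-a, 1:])"
    unfolding A_def by (rule complex_poly_decompose_multiset[symmetric])
  have A: "a \<in># A \<longleftrightarrow> poly p a = 0" for a
    using assms(1) by (simp add: A_def)
  have s: "size A = degree p"
    unfolding A_def by (rule size_proots_complex)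
  have "\<forall>a\<in>#A. Im a < Im x"
    using A assms(2) by blast
  then obtain S and T :: real where *: "poly (pderiv (\<Prod>a\<in>#A. [:-a, 1:])) x = S * poly (\<Prod>a\<in>#A. [:-a, 1:]) x"
    "(cmod S)\<^sup>2 \<le> size A * T" "(\<forall>a\<in>#A. Im a \<le> 0) \<longrightarrow> Im x * T \<le> - Im S"
    "A \<noteq> {#} \<longrightarrow> Im S < 0"
    by (rule log_derivative_prod_linear)
  show thesis
  proof
    show "poly (pderiv p) x = S * poly p x"
      using arg_cong[OF p, of "\<lambda>q. poly (pderiv q) x"] arg_cong[OF p, of "\<lambda>q. poly q x"] *(1)
      unfolding pderiv_smult poly_smult by (metis mult.left_commute)
    show "(cmod S)\<^sup>2 \<le> degree p * T"
      using *(2) s by simp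
    show "(\<forall>a. poly p a = 0 \<longrightarrow> Im a \<le> 0) \<longrightarrow> Im x * T \<le> - Im S"
      using *(3) A by blast
    show "degree p > 0 \<longrightarrow> Im S < 0"
      using *(4) s by auto
  qed
qed

section \<open>Laguerre's theorem and polarization\<close>

text \<open>
  The points \<open>1 / (x - a)\<close> with \<open>Im a \<le> 0\<close> fill a disc through the origin; the average of the
  \<open>1 / (x - a)\<close> over the zeros \<open>a\<close> of \<open>p\<close>, counting \<open>\<infinity>\<close> with multiplicity \<open>n - degree p\<close>, lies in
  this disc, whereas \<open>1 / (x - \<zeta>)\<close> does not.
\<close>

lemma laguerre_upper_halfplane:
  fixes p :: "complex poly"
  assumes deg: "degree p \<le> n" and n: "n > 0" and x: "Im x > 0" and \<zeta>: "Im \<zeta> > 0"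
    and nz: "\<And>y. Im y > 0 \<Longrightarrow> poly p y \<noteq> 0"
  shows "of_nat n * poly p x + (\<zeta> - x) * poly (pderiv p) x \<noteq> 0"
proof
  assume eq: "of_nat n * poly p x + (\<zeta> - x) * poly (pderiv p) x = 0"
  have roots: "Im a \<le> 0" if "poly p a = 0" for a
    using nz[of a] that by force
  have "p \<noteq> 0"
    using nz[OF x] by auto
  moreover have "Im a < Im x" if "poly p a = 0" for a
    using roots[OF that] x by simp
  ultimately obtain S and T :: real where S: "poly (pderiv p) x = S * poly p x" "(cmod S)\<^sup>2 \<le> degree p * T"
    "(\<forall>a. poly p a = 0 \<longrightarrow> Im a \<le> 0) \<longrightarrow> Im x * T \<le> - Im S"
    "degree p > 0 \<longrightarrow> Im S < 0"
    by (rule log_derivative_poly)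
  define w where "w = x - \<zeta>"
  \<comment> \<open>The assumed zero of the polar derivative means \<open>S / n = 1 / w\<close>, the
    point that should lie outside the disc.\<close>
  have "(of_nat n - w * S) * poly p x = 0"
    using eq S(1) by (simp add: w_def algebra_simps)
  then have wS: "w * S = of_nat n"
    using nz[OF x] by simp
  then have "w \<noteq> 0"
    using n by auto
  then have SS: "S = of_nat n / w"
    using wS by (simp add: field_simps)
  have w: "(cmod w)\<^sup>2 > 0"
    using \<open>w \<noteq> 0\<close> by simp
  have cS: "(cmod S)\<^sup>2 = (real n)\<^sup>2 / (cmod w)\<^sup>2" and IS: "Im S = - real n * Im w / (cmod w)\<^sup>2"
    by (auto simp: SS norm_divide power_divide Im_divide cmod_power2)
  have T: "Im x * T \<le> - Im S"
    using S(3) roots by blast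
  have "0 \<le> T"
  \<comment> \<open>For constant \<open>p\<close> the bound on \<open>S\<close> would force
    \<open>S = 0\<close>, contradicting \<open>S = n / w\<close>.\<close>
  proof (cases "degree p = 0")
    case True
    then have "(cmod S)\<^sup>2 \<le> 0"
      using S(2) by simp
    then show ?thesis
      using n SS \<open>w \<noteq> 0\<close> by simp
  next
    case False
    have "0 \<le> degree p * T"
      using S(2) by (rule order_trans[rotated]) simp
    then show ?thesis
      using False by (simp add: zero_le_mult_iff)
  qed
  \<comment> \<open>Replacing \<open>degree p\<close> by \<open>n\<close> accounts for the zeros at
    infinity, whose reciprocals are 0. With \<open>S = n / w\<close> the chain gives
    \<open>Im x \<le> Im w\<close>, contradicting \<open>Im \<zeta> > 0\<close>.\<close>
  have "Im x * (cmod S)\<^sup>2 \<le> Im x * (degree p * T)"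
    using x S(2) by (intro mult_left_mono) auto
  also have "\<dots> \<le> Im x * (n * T)"
    using x deg \<open>0 \<le> T\<close> by (intro mult_left_mono mult_right_mono) auto
  also have "\<dots> \<le> n * (- Im S)"
    using mult_left_mono[OF T, of "real n"] by (simp add: algebra_simps)
  finally have "Im x * (real n)\<^sup>2 / (cmod w)\<^sup>2 \<le> (real n)\<^sup>2 * Im w / (cmod w)\<^sup>2"
    unfolding cS IS power2_eq_square[of "real n"] by (simp only: minus_divide_left mult_minus_left minus_minus times_divide_eq_right mult.assoc)
  then have "Im x * (real n)\<^sup>2 \<le> (real n)\<^sup>2 * Im w"
    using w by (simp only: divide_le_cancel)
  then have "Im x \<le> Im w"
    using n by (simp add: mult.commute)
  then show False
    using \<zeta> by (simp add: w_def)
qed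

text \<open>
  Fixing the last variable turns the polarization of \<open>p\<close> into that of its polar derivative, so the
  Grace--Walsh--Szego theorem reduces to Laguerre's theorem.
\<close>

lemma polarization_nonzero:
  fixes b :: "nat \<Rightarrow> complex"
  assumes "\<And>x. Im x > 0 \<Longrightarrow> (\<Sum>k\<le>d. of_nat (d choose k) * b k * x ^ k) \<noteq> 0"
    and "\<And>j. j < d \<Longrightarrow> Im (z j) > 0"
  shows "(\<Sum>A\<in>Pow {..<d}. b (card A) * (\<Prod>j\<in>A. z j)) \<noteq> 0"
  using assms
proof (induction d arbitrary: b)
  case 0
  then show ?case
    using 0(1)[of \<i>] by simp
next
  case (Suc d)
  define p where "p = (\<Sum>k\<le>Suc d. monom (of_nat (Suc d choose k) * b k) k)"
  have poly_p: "poly p x = (\<Sum>k\<le>Suc d. of_nat (Suc d choose k) * b k * x ^ k)" for x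
    by (simp add: p_def poly_sum poly_monom)
  have "degree p \<le> Suc d"
    unfolding p_def by (rule degree_sum_le) (auto intro: order_trans[OF degree_monom_le])
  have pd: "poly (pderiv p) x = of_nat (Suc d) * (\<Sum>k\<le>d. of_nat (d choose k) * b (Suc k) * x ^ k)" for x
  proof -
    have "poly (pderiv p) x =
        (\<Sum>k\<le>Suc d. of_nat k * (of_nat (Suc d choose k) * b k) * x ^ (k - 1))"
      by (simp only: p_def higher_pderiv_sum[of 1, simplified] pderiv_monom poly_sum poly_monom)
    also have "\<dots> = (\<Sum>k\<le>d. of_nat (Suc k * (Suc d choose Suc k)) * b (Suc k) * x ^ k)"
      by (subst sum.atMost_Suc_shift) (simp add: mult.assoc del: binomial_Suc_Suc of_nat_Suc mult_Suc)
    also have "\<dots> = of_nat (Suc d) * (\<Sum>k\<le>d. of_nat (d choose k) * b (Suc k) * x ^ k)"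
      unfolding Suc_times_binomial by (simp only: sum_distrib_left of_nat_mult mult.assoc)
    finally show ?thesis .
  qed
  \<comment> \<open>Pascal's rule. Combined with \<open>pd\<close>, the explicit factor
    \<open>x\<close> of the second sum becomes \<open>z d\<close> in the polar derivative.\<close>
  have pp: "poly p x = (\<Sum>k\<le>d. of_nat (d choose k) * b k * x ^ k)
      + x * (\<Sum>k\<le>d. of_nat (d choose k) * b (Suc k) * x ^ k)" for x
  proof -
    have "poly p x = b 0 + (\<Sum>k\<le>d. of_nat (d choose Suc k) * b (Suc k) * x ^ Suc k)
        + x * (\<Sum>k\<le>d. of_nat (d choose k) * b (Suc k) * x ^ k)"
      unfolding poly_p
      by (subst sum.atMost_Suc_shift) (simp add: algebra_simps sum.distrib sum_distrib_left)
    also have "b 0 + (\<Sum>k\<le>d. of_nat (d choose Suc k) * b (Suc k) * x ^ Suc k) =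
        (\<Sum>k\<le>Suc d. of_nat (d choose k) * b k * x ^ k)"
      by (subst sum.atMost_Suc_shift) simp
    finally show ?thesis
      by simp
  qed
  \<comment> \<open>\<open>b' k\<close> collects the weights of a \<open>k\<close>-subset of
    \<open>{..<d}\<close> and of its extension by \<open>d\<close>, the latter with the factor
    \<open>z d\<close>.\<close>
  define b' where "b' k = b k + z d * b (Suc k)" for k
  have "(\<Sum>A\<in>Pow {..<d}. b' (card A) * (\<Prod>j\<in>A. z j)) \<noteq> 0"
  proof (rule Suc.IH)
    fix x :: complex assume x: "Im x > 0"
    have "of_nat (Suc d) * poly p x + (z d - x) * poly (pderiv p) x \<noteq> 0"
      using \<open>degree p \<le> Suc d\<close> x Suc.prems by (intro laguerre_upper_halfplane) (auto simp only: poly_p lessI zero_less_Suc)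
    also have "of_nat (Suc d) * poly p x + (z d - x) * poly (pderiv p) x =
        of_nat (Suc d) * ((\<Sum>k\<le>d. of_nat (d choose k) * b k * x ^ k)
          + z d * (\<Sum>k\<le>d. of_nat (d choose k) * b (Suc k) * x ^ k))"
      unfolding pp pd by algebra
    also have "(\<Sum>k\<le>d. of_nat (d choose k) * b k * x ^ k)
          + z d * (\<Sum>k\<le>d. of_nat (d choose k) * b (Suc k) * x ^ k) =
        (\<Sum>k\<le>d. of_nat (d choose k) * b' k * x ^ k)"
      unfolding b'_def by (simp add: sum_distrib_left sum.distrib distrib_left distrib_right mult_ac)
    finally show "(\<Sum>k\<le>d. of_nat (d choose k) * b' k * x ^ k) \<noteq> 0"
      by auto
  qed (use Suc.prems in auto)
  also have "(\<Sum>A\<in>Pow {..<d}. b' (card A) * (\<Prod>j\<in>A. z j)) =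
      (\<Sum>A\<in>Pow {..<Suc d}. b (card A) * (\<Prod>j\<in>A. z j))"
  proof -
    have P: "Pow {..<Suc d} = Pow {..<d} \<union> insert d ` Pow {..<d}"
      by (simp add: lessThan_Suc Pow_insert)
    have inj: "inj_on (insert d) (Pow {..<d})"
      by (rule inj_onI) (auto simp: insert_ident subset_iff)
    have A: "finite A \<and> d \<notin> A" if "A \<in> Pow {..<d}" for A
      using that finite_subset[of A "{..<d}"] by auto
    have "(\<Sum>A\<in>insert d ` Pow {..<d}. b (card A) * (\<Prod>j\<in>A. z j)) =
        (\<Sum>A\<in>Pow {..<d}. z d * b (Suc (card A)) * (\<Prod>j\<in>A. z j))"
      using A by (subst sum.reindex[OF inj]) (auto intro!: sum.cong)
    then show ?thesis
      unfolding P by (subst sum.union_disjoint) (auto simp: b'_def algebra_simps sum.distrib)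
  qed
  finally show ?case .
qed

section \<open>Gauss--Lucas and binomial multipliers\<close>

text \<open>Substituting \<open>t = y / w\<close> turns the half plane into the lower one. At a
  critical point outside it the logarithmic derivative would be 0, yet its imaginary part is
  negative there.\<close>

lemma gauss_lucas_halfplane:
  fixes p :: "complex poly"
  assumes "w \<noteq> 0" "degree p > 0" and roots: "\<And>t. poly p t = 0 \<Longrightarrow> Im (w * t) < 0"
    and "poly (pderiv p) t = 0"
  shows "Im (w * t) < 0"
proof (rule ccontr)
  assume t: "\<not> Im (w * t) < 0"
  define q where "q = pcompose p [:0, 1 / w:]"
  have q: "poly q y = poly p (y / w)" for y
    by (simp add: q_def poly_pcompose)
  have dq: "degree q = degree p"
    using assms(1) by (simp add: q_def degree_pcompose)
  have "q \<noteq> 0"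
    using assms(2) dq by auto
  moreover have "Im a < Im (w * t)" if "poly q a = 0" for a
    using roots[of "a / w"] that t assms(1) by (simp add: q)
  ultimately obtain S and T :: real where S: "poly (pderiv q) (w * t) = S * poly q (w * t)"
    "(cmod S)\<^sup>2 \<le> degree q * T"
    "(\<forall>a. poly q a = 0 \<longrightarrow> Im a \<le> 0) \<longrightarrow> Im (w * t) * T \<le> - Im S"
    "degree q > 0 \<longrightarrow> Im S < 0"
    by (rule log_derivative_poly)
  have "poly (pderiv q) (w * t) = 0"
    using assms(1,4) by (simp add: q_def pderiv_pcompose poly_pcompose)
  moreover have "poly q (w * t) \<noteq> 0"
    using roots[of t] t assms(1) by (auto simp: q)
  ultimately show False
    using S(1,4) assms(2) dq by auto
qed

text \<open>Iterating Gauss--Lucas keeps the zeros of the first \<open>n\<close> derivatives in an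
  open half plane that misses 0. So the \<open>n\<close>-th derivative does not vanish at 0, where
  its value is \<open>n!\<close> times the coefficient.\<close>

lemma coeff_nonzero_of_roots_halfplane:
  fixes p :: "complex poly"
  assumes "w \<noteq> 0" "n \<le> degree p" and "\<And>t. poly p t = 0 \<Longrightarrow> Im (w * t) < 0"
  shows "coeff p n \<noteq> 0"
proof -
  have "degree ((pderiv ^^ m) p) = degree p - m \<and> (\<forall>t. poly ((pderiv ^^ m) p) t = 0 \<longrightarrow> Im (w * t) < 0)"
    if "m \<le> n" for m
    using that
  proof (induction m)
    case (Suc m)
    then have "degree ((pderiv ^^ m) p) > 0"
      using assms(2) by simp
    with Suc show ?case
      using gauss_lucas_halfplane[OF assms(1), of "(pderiv ^^ m) p"] by (auto simp: degree_pderiv)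
  qed (use assms in auto)
  from this[of n] have "poly ((pderiv ^^ n) p) 0 \<noteq> 0"
    by auto
  then show ?thesis
    by (auto simp: poly_0_coeff_0 coeff_higher_pderiv)
qed

text \<open>
  The new value at \<open>x\<close> is the coefficient of \<open>t\<^sup>d\<close> in \<open>(1 + t)\<^sup>d \<cdot> t\<^sup>d q(x/t)\<close>, where \<open>q\<close> is the old
  polynomial. The zeros of this polynomial in \<open>t\<close> lie on the rays through \<open>-1\<close> and \<open>-x\<close>, hence in
  an open half plane with \<open>0\<close> on its boundary.
\<close>

lemma binomial_multiplier_nonzero:
  fixes a :: "nat \<Rightarrow> complex"
  assumes q: "\<And>x. x \<notin> \<real>\<^sub>\<le>\<^sub>0 \<Longrightarrow> (\<Sum>k\<le>d. a k * x ^ k) \<noteq> 0" and "a d \<noteq> 0" and x: "x \<notin> \<real>\<^sub>\<le>\<^sub>0"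
  shows "(\<Sum>k\<le>d. of_nat (d choose k) * a k * x ^ k) \<noteq> 0"
proof -
  define g where "g = (\<Sum>k\<le>d. monom (a k * x ^ k) (d - k))"
  define f where "f = [:1, 1:] ^ d * g"
  \<comment> \<open>\<open>w\<close> is \<open>\<i>\<close> times the conjugate of
    \<open>cmod x + x\<close>, which bisects the angle between 1 and \<open>x\<close>. So 1 and
    \<open>x\<close> both satisfy \<open>Im (w * t) > 0\<close>, and -1 and \<open>-x\<close> lie in
    the opposite half plane.\<close>
  define w where "w = \<i> * (of_real (cmod x) + cnj x)"
  have x0: "x \<noteq> 0"
    using x by auto
  have pos: "cmod x + Re x > 0"
  proof (rule ccontr)
    assume n: "\<not> cmod x + Re x > 0"
    then have "Re x = - cmod x"
      using abs_Re_le_cmod[of x] by simp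
    moreover from this have "Im x = 0"
      using cmod_power2[of x] by simp
    ultimately show False
      using x by (simp add: complex_nonpos_Reals_iff)
  qed
  have w1: "Im w > 0"
    using pos by (simp add: w_def)
  have wx: "Im (w * x) > 0"
  proof -
    have "w * x = \<i> * (of_real (cmod x) * x + of_real ((cmod x)\<^sup>2))"
      using complex_norm_square[of x] by (simp add: w_def algebra_simps)
    then have "Im (w * x) = cmod x * (cmod x + Re x)"
      by (simp add: algebra_simps power2_eq_square)
    then show ?thesis
      using pos x0 by simp
  qed
  \<comment> \<open>The constant coefficient of \<open>g\<close> is \<open>a d * x ^ d\<close>.
    Zeros \<open>t\<close> of \<open>g\<close> are thus nonzero, and \<open>x / t\<close> makes
    sense.\<close>
  have g0: "poly g 0 \<noteq> 0"
  proof -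
    have "poly g 0 = (\<Sum>k\<le>d. if k = d then a d * x ^ d else 0)"
      unfolding g_def poly_sum poly_monom by (intro sum.cong) (auto simp: power_0_left)
    then show ?thesis
      using x0 assms(2) by simp
  qed
  have g_root: "Im (w * t) < 0" if t: "poly g t = 0" for t
  proof -
    have "t \<noteq> 0"
      using t g0 by auto
    have "poly g t = t ^ d * (\<Sum>k\<le>d. a k * (x / t) ^ k)"
      unfolding g_def poly_sum poly_monom sum_distrib_left
      by (intro sum.cong refl) (use \<open>t \<noteq> 0\<close> in \<open>simp add: power_diff power_divide\<close>)
    then have "(\<Sum>k\<le>d. a k * (x / t) ^ k) = 0"
      using t \<open>t \<noteq> 0\<close> by simp
    then have "x / t \<in> \<real>\<^sub>\<le>\<^sub>0"
      using q by blast
    then obtain s where s: "x / t = of_real s" "s \<le> 0"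
      by (rule nonpos_Reals_cases)
    then have "s < 0"
      using x0 \<open>t \<noteq> 0\<close> by (cases "s = 0") auto
    have wx_eq: "w * x = of_real s * (w * t)"
      using s(1) \<open>t \<noteq> 0\<close> by (simp add: field_simps)
    have "Im (w * x) = s * Im (w * t)"
      unfolding wx_eq by simp
    then show ?thesis
      using wx \<open>s < 0\<close> by (simp add: zero_less_mult_iff)
  qed
  have "g \<noteq> 0"
    using g0 by auto
  then have "degree f \<ge> d"
    by (simp add: f_def degree_mult_eq degree_power_eq)
  moreover have "Im (w * t) < 0" if "poly f t = 0" for t
  proof -
    have "1 + t = 0 \<or> poly g t = 0"
      using that by (auto simp: f_def poly_power)
    then show ?thesis
    proof
      assume "1 + t = 0"
      then have "t = -1"
        by (simp add: add_eq_0_iff)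
      then show ?thesis
        using w1 by simp
    qed (rule g_root)
  qed
  ultimately have "coeff f d \<noteq> 0"
    using w1 by (intro coeff_nonzero_of_roots_halfplane[of w]) auto
  also have "coeff f d = (\<Sum>k\<le>d. of_nat (d choose k) * a k * x ^ k)"
  proof -
    have c: "coeff ([:1, 1:] ^ d :: complex poly) k = of_nat (d choose k)" if "k \<le> d" for k
      using that by (simp add: coeff_linear_poly_power)
    have gk: "coeff g (d - k) = a k * x ^ k" if "k \<le> d" for k
    proof -
      have "coeff g (d - k) = (\<Sum>l\<le>d. if l = k then a k * x ^ k else 0)"
        unfolding g_def coeff_sum coeff_monom using that by (intro sum.cong) auto
      then show ?thesis
        using that by simp
    qed
    show ?thesis
      unfolding f_def coeff_mult by (intro sum.cong refl) (simp add: c gk mult.assoc)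
  qed
  finally show ?thesis .
qed

section \<open>The generating polynomial of the CMB distribution\<close>

text \<open>Induction on the exponent: for exponent 1 the binomial theorem leaves
  \<open>(r - 1) / r\<close> as the only possible zero, and each step multiplies by one more
  binomial coefficient. The claim is made on the slit plane because
  \<open>binomial_multiplier_nonzero\<close> takes it as input and reproduces it there.\<close>

lemma CMB_polynomial_nonzero:
  assumes r: "0 < r" "r < 1" and x: "x \<notin> \<real>\<^sub>\<le>\<^sub>0"
  shows "(\<Sum>k\<le>d. of_real (real (d choose k) ^ Suc n * r ^ k * (1 - r) ^ (d - k)) * (x::complex) ^ k) \<noteq> 0"
  using x
proof (induction n arbitrary: x)
  case 0
  have "(\<Sum>k\<le>d. of_real (real (d choose k) ^ Suc 0 * r ^ k * (1 - r) ^ (d - k)) * x ^ k) =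
      (of_real r * x + of_real (1 - r)) ^ d"
    by (subst binomial_ring) (simp add: power_mult_distrib mult_ac)
  moreover have "of_real r * x + of_real (1 - r) \<noteq> 0"
  proof
    assume "of_real r * x + of_real (1 - r) = 0"
    then have "of_real r * x = of_real (r - 1)"
      by (simp add: algebra_simps add_eq_0_iff)
    then have "x = of_real ((r - 1) / r)"
      using r by (simp add: field_simps)
    moreover have "(r - 1) / r \<le> 0"
      using r by (simp add: divide_le_0_iff)
    ultimately show False
      using 0 by (metis nonpos_Reals_of_real_iff)
  qed
  ultimately show ?case
    by simp
next
  case (Suc n)
  have "(\<Sum>k\<le>d. of_nat (d choose k) *
      complex_of_real (real (d choose k) ^ Suc n * r ^ k * (1 - r) ^ (d - k)) * x ^ k) \<noteq> 0"
    by (rule binomial_multiplier_nonzero[OF Suc.IH _ Suc.prems]) (use r in auto)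
  then show ?case
    by (simp add: mult_ac)
qed

section \<open>Multivariate generating functions and real stability\<close>

lemma sum_cube_eq_sum_Pow:
  fixes b :: "nat \<Rightarrow> 'a::comm_semiring_1"
  shows "(\<Sum>i\<in>cube d. b (\<Sum>j<d. i j) * (\<Prod>j<d. z j ^ i j)) =
    (\<Sum>A\<in>Pow {..<d}. b (card A) * (\<Prod>j\<in>A. z j))"
\<comment> \<open>A 0-1 vector corresponds to its set of ones; restricting the indicator gives the
  value \<open>undefined\<close> outside \<open>{..<d}\<close> that \<open>cube\<close>
  demands.\<close>
proof (rule sum.reindex_bij_witness[where
      i = "\<lambda>A. \<lambda>j\<in>{..<d}. if j \<in> A then 1 else 0" and j = "\<lambda>i. {j. j < d \<and> i j = 1}"])
  fix i assume i: "i \<in> cube d"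
  show "(\<lambda>j\<in>{..<d}. if j \<in> {j. j < d \<and> i j = 1} then 1 else 0) = i"
    using cube_values[OF i] cube_outside[OF i] by fastforce
  have "(\<Prod>j<d. z j ^ i j) = (\<Prod>j\<in>{j. j < d \<and> i j = 1}. z j)"
    by (intro prod.mono_neutral_cong_right) (use cube_values[OF i] in fastforce)+
  then show "b (card {j. j < d \<and> i j = 1}) * (\<Prod>j\<in>{j. j < d \<and> i j = 1}. z j) =
      b (\<Sum>j<d. i j) * (\<Prod>j<d. z j ^ i j)"
    by (simp add: cube_sum[OF i])
qed (auto simp: cube_def)

lemma mpoly_eval_0 [simp]: "mpoly_eval z 0 = 0"
  by (simp add: mpoly_eval_def)

lemma mpoly_vars_sum_single:
  assumes "\<And>a. a \<in> A \<Longrightarrow> Poly_Mapping.keys (m a) \<subseteq> V"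
  shows "mpoly_vars (\<Sum>a\<in>A. Poly_Mapping.single (m a) (c a)) \<subseteq> V"
proof -
  have "Poly_Mapping.keys (\<Sum>a\<in>A. Poly_Mapping.single (m a) (c a)) \<subseteq> m ` A"
    by (rule order_trans[OF keys_sum]) auto
  then show ?thesis
    using assms by (fastforce simp: mpoly_vars_def)
qed

text \<open>Both \<open>pgf\<close> and \<open>joint_pgf\<close> have this shape, so the analytic
  content of their real stability is nonvanishing. This also makes the polynomial itself nonzero, on
  evaluating at \<open>\<i>\<close> in every variable.\<close>

lemma real_stable_sum_single:
  assumes "\<And>a. a \<in> A \<Longrightarrow> Poly_Mapping.keys (m a) \<subseteq> {..<n}"
    and "\<And>z. (\<And>j. j < n \<Longrightarrow> Im (z j) > 0) \<Longrightarrow>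
      mpoly_eval z (\<Sum>a\<in>A. Poly_Mapping.single (m a) (complex_of_real (c a))) \<noteq> 0"
  shows "real_stable n (\<Sum>a\<in>A. Poly_Mapping.single (m a) (complex_of_real (c a)))"
  unfolding real_stable_def stable_def
proof (intro conjI allI impI)
  show "(\<Sum>a\<in>A. Poly_Mapping.single (m a) (complex_of_real (c a))) \<noteq> 0"
    using assms(2)[of "\<lambda>_. \<i>"] by auto
  show "Poly_Mapping.lookup (\<Sum>a\<in>A. Poly_Mapping.single (m a) (complex_of_real (c a))) l \<in> \<real>" for l
    by (auto simp: lookup_sum lookup_single when_def intro!: sum_in_Reals)
  show "mpoly_vars (\<Sum>a\<in>A. Poly_Mapping.single (m a) (complex_of_real (c a))) \<subseteq> {..<n}"
    by (rule mpoly_vars_sum_single[OF assms(1)])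
qed (use assms(2) in auto)

theorem theorem3p1:
  fixes d \<nu> :: nat and r :: real and M :: "'a measure" and W :: "'a \<Rightarrow> nat"
  assumes "d \<ge> 1" and "0 < r" and "r < 1" and "\<nu> \<ge> 1"
    and "CMB_distributed d r (real \<nu>) M W"
  shows "SR_variable d M W \<and>
    (\<forall>(N :: 'b measure) I. underlying_vector d M W N I \<longrightarrow> SR_vector d N I)"
proof -
  define S where "S = (\<Sum>l\<le>d. CMB_weight d r (real \<nu>) l)"
  define P where "P k = \<P>(\<omega> in M. W \<omega> = k)" for k
  have M: "prob_space M" "W \<in> measurable M (count_space {..d})"
    using assms(5) by (auto simp: CMB_distributed_def)
  have P: "P k = CMB_weight d r (real \<nu>) k / S" if "k \<le> d" for k
    using assms(5) that by (auto simp: CMB_distributed_def S_def P_def)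
  obtain n where n: "\<nu> = Suc n"
    using assms(4) by (cases \<nu>) auto
  \<comment> \<open>For \<open>k \<le> d\<close> the binomial coefficient is positive, so
    \<open>powr\<close> with exponent \<open>real \<nu>\<close> is an ordinary power.\<close>
  have weight: "CMB_weight d r (real \<nu>) k = real (d choose k) ^ Suc n * r ^ k * (1 - r) ^ (d - k)"
    if "k \<le> d" for k
    using that by (simp add: CMB_weight_def n powr_realpow flip: of_nat_Suc)
  have "S > 0"
    unfolding S_def using assms by (intro sum_pos) (auto simp: weight)
  have nz: "(\<Sum>k\<le>d. complex_of_real (P k) * x ^ k) \<noteq> 0" if "Im x > 0" for x
  proof -
    have "(\<Sum>k\<le>d. complex_of_real (P k) * x ^ k) =
        (\<Sum>k\<le>d. of_real (real (d choose k) ^ Suc n * r ^ k * (1 - r) ^ (d - k)) * x ^ k) / of_real S"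
      unfolding sum_divide_distrib by (intro sum.cong refl) (simp add: P weight)
    moreover have "x \<notin> \<real>\<^sub>\<le>\<^sub>0"
      using that by (simp add: complex_nonpos_Reals_iff)
    ultimately show ?thesis
      using CMB_polynomial_nonzero[OF assms(2,3)] \<open>S > 0\<close> by simp
  qed
  have "SR_variable d M W"
    unfolding SR_variable_def pgf_def
    by (rule real_stable_sum_single) (use nz in \<open>auto simp: P_def mpoly_eval_pgf simp flip: pgf_def\<close>)
  moreover have "SR_vector d N I" if "underlying_vector d M W N I" for N :: "'b measure" and I
  proof -
    \<comment> \<open>\<open>b k\<close> is the probability of each single vector with
      \<open>k\<close> ones, so the joint generating function is the polarization of the univariate
      one.\<close>
    define b where "b k = complex_of_real (P k / real (d choose k))" for k
    have prob: "\<P>(\<omega> in N. I \<omega> = i) = P (\<Sum>j<d. i j) / real (d choose (\<Sum>j<d. i j))"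
      if "i \<in> cube d" for i
      using \<open>underlying_vector d M W N I\<close> that unfolding underlying_vector_iff[OF M] P_def by blast
    have "mpoly_eval z (joint_pgf d N I) \<noteq> 0" if z: "\<And>j. j < d \<Longrightarrow> Im (z j) > 0" for z
    proof -
      have "mpoly_eval z (joint_pgf d N I) = (\<Sum>i\<in>cube d. b (\<Sum>j<d. i j) * (\<Prod>j<d. z j ^ i j))"
        unfolding mpoly_eval_joint_pgf b_def by (intro sum.cong refl) (simp only: prob)
      moreover have "(\<Sum>k\<le>d. of_nat (d choose k) * b k * x ^ k) \<noteq> 0" if "Im x > 0" for x
      proof -
        have "(\<Sum>k\<le>d. of_nat (d choose k) * b k * x ^ k) = (\<Sum>k\<le>d. complex_of_real (P k) * x ^ k)"
          by (intro sum.cong refl) (simp add: b_def)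
        then show ?thesis
          using nz[OF that] by simp
      qed
      ultimately show ?thesis
        using polarization_nonzero[of d b z] z by (simp add: sum_cube_eq_sum_Pow)
    qed
    moreover have "Poly_Mapping.keys (\<Sum>j<d. Poly_Mapping.single j (i j)) \<subseteq> {..<d}" for i :: "nat \<Rightarrow> nat"
      by (rule order_trans[OF keys_sum]) auto
    ultimately show ?thesis
      unfolding SR_vector_def joint_pgf_def by (intro real_stable_sum_single) auto
  qed
  ultimately show ?thesis
    by blast
qed

end
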